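(* Let $X$ be a compact metric space, let $(B_{ss},\|\cdot\|_{ss})\subseteq (B_s,\|\cdot\|_s)\subseteq (B_w,\|\cdot\|_w)$ be normed vector spaces of signed Borel measures on $X$ as described in the context, with zero-average subspaces $V_{ss},V_s,V_w$, and let $\overline{\delta}>0$. Let $(L_\delta)_{\delta\in[0,\overline\delta)}$ be a family of bounded Markov operators $L_\delta:B_i\to B_i$, $i\in\{ss,s,w\}$, satisfying the following. (LR1) For each $\delta\in[0,\overline\delta)$ there is a probability measure $h_\delta\in B_{ss}$ with $L_\delta h_\delta=h_\delta$. Furthermore there is $M\ge 0$ such that $\|h_\delta\|_{ss}\le M$ for each $\delta\in[0,\overline\delta)$. (LR2) There is a sequence $a_n\to 0$ such that for each $g\in V_{ss}$ and each $n$, $\|L_0^n g\|_s\le a_n\|g\|_{ss}$. (LR3) $(Id-L_0)^{-1}:=\sum_{i=0}^\infty L_0^i$ is a bounded operator $V_w\to V_w$. (LR4) There is $K\ge 0$ such that $\|L_0-L_\delta\|_{B_s\to B_w}\le K\delta$ and $\|L_0-L_\delta\|_{B_{ss}\to B_s}\le K\delta$ for all $\delta \in [0,\overline\delta)$. There is an element $\dot L h_0\in V_w$ such that $$\lim_{\delta\to0}\left\|\frac{L_\delta-L_0}{\delta}h_0-\dot L h_0\right\|_w=0.$$ Then $$\lim_{\delta\to 0}\left\|\frac{h_\delta-h_0}{\delta}-(Id-L_0)^{-1}\dot L h_0\right\|_w=0.$$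
   Context: $BS(X)$ denotes the space of signed Borel measures on the compact metric space $X$. The spaces $B_{ss}\subseteq B_s\subseteq B_w\subseteq BS(X)$ are normed vector spaces with $\|\cdot\|_w\le\|\cdot\|_s\le\|\cdot\|_{ss}$ (they may coincide), and the linear form $\mu\mapsto\mu(X)$ is assumed continuous on each $B_i$, $i\in\{ss,s,w\}$. Put $V_i:=\{\mu\in B_i:\mu(X)=0\}$. A Markov operator is a linear operator $L$ preserving positive measures and such that $[L(\mu)](X)=\mu(X)$ for each positive measure $\mu$. For normed spaces $A,B$ and $T:A\to B$, $\|T\|_{A\to B}:=\sup_{f\in A,\|f\|_A\le1}\|Tf\|_B$. *)

theory Defs
  imports "HOL-Analysis.Analysis"
begin

section \<open>The vector space of signed Borel measures\<close>

text \<open>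
  Signed Borel measures are finite, i.e. real-valued countably additive set functions on the
  Borel sets. They are set to 0 outside the Borel sigma-algebra, so that two of them are equal
  iff they agree on all Borel sets.
\<close>

definition signed_borel :: "('a::topological_space set \<Rightarrow> real) \<Rightarrow> bool" where
  "signed_borel m \<longleftrightarrow>
     m {} = 0 \<and>
     (\<forall>A. A \<notin> sets borel \<longrightarrow> m A = 0) \<and>
     (\<forall>F :: nat \<Rightarrow> 'a set. range F \<subseteq> sets borel \<longrightarrow> disjoint_family F \<longrightarrow>
        (\<lambda>n. m (F n)) sums m (\<Union>n. F n))"

typedef (overloaded) 'a::topological_space signed_measure =
    "{m :: 'a set \<Rightarrow> real. signed_borel m}"
  morphisms smeasure Abs_signed_measure
  by (rule exI[of _ "\<lambda>_. 0"]) (simp add: signed_borel_def)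

setup_lifting type_definition_signed_measure

instantiation signed_measure :: (topological_space) real_vector
begin

lift_definition zero_signed_measure :: "'a signed_measure" is "\<lambda>_. 0"
  by (simp add: signed_borel_def)

lift_definition plus_signed_measure ::
    "'a signed_measure \<Rightarrow> 'a signed_measure \<Rightarrow> 'a signed_measure"
  is "\<lambda>m n A. m A + n A"
  by (simp add: signed_borel_def sums_add)

lift_definition minus_signed_measure ::
    "'a signed_measure \<Rightarrow> 'a signed_measure \<Rightarrow> 'a signed_measure"
  is "\<lambda>m n A. m A - n A"
  by (simp add: signed_borel_def sums_diff)

lift_definition uminus_signed_measure :: "'a signed_measure \<Rightarrow> 'a signed_measure"
  is "\<lambda>m A. - m A"
  by (simp add: signed_borel_def sums_minus)

lift_definition scaleR_signed_measure :: "real \<Rightarrow> 'a signed_measure \<Rightarrow> 'a signed_measure"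
  is "\<lambda>c m A. c * m A"
  by (simp add: signed_borel_def sums_mult)

instance
  by standard (transfer; simp add: fun_eq_iff algebra_simps)+

end

definition total_mass :: "'a::topological_space signed_measure \<Rightarrow> real" where
  "total_mass \<mu> = smeasure \<mu> UNIV"

definition positive_measure :: "'a::topological_space signed_measure \<Rightarrow> bool" where
  "positive_measure \<mu> \<longleftrightarrow> (\<forall>A\<in>sets borel. 0 \<le> smeasure \<mu> A)"

definition probability_measure :: "'a::topological_space signed_measure \<Rightarrow> bool" where
  "probability_measure \<mu> \<longleftrightarrow> positive_measure \<mu> \<and> total_mass \<mu> = 1"

definition zero_average ::
    "'a::topological_space signed_measure set \<Rightarrow> 'a signed_measure set" where
  "zero_average B = {\<mu> \<in> B. total_mass \<mu> = 0}"


section \<open>Normed subspaces and bounded operators\<close>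

text \<open>
  A normed space is a subspace \<open>B\<close> of a real vector space together with a function \<open>nrm\<close> that is
  a norm on \<open>B\<close>; the values of \<open>nrm\<close> outside \<open>B\<close> are irrelevant. Likewise an operator on \<open>B\<close> is a
  function on the ambient space of which only the values on \<open>B\<close> matter.
\<close>

definition normed_subspace :: "'v::real_vector set \<Rightarrow> ('v \<Rightarrow> real) \<Rightarrow> bool" where
  "normed_subspace B nrm \<longleftrightarrow>
     subspace B \<and>
     (\<forall>x\<in>B. 0 \<le> nrm x \<and> (nrm x = 0 \<longleftrightarrow> x = 0)) \<and>
     (\<forall>c. \<forall>x\<in>B. nrm (c *\<^sub>R x) = \<bar>c\<bar> * nrm x) \<and>
     (\<forall>x\<in>B. \<forall>y\<in>B. nrm (x + y) \<le> nrm x + nrm y)"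

definition continuous_functional ::
    "'v::real_vector set \<Rightarrow> ('v \<Rightarrow> real) \<Rightarrow> ('v \<Rightarrow> real) \<Rightarrow> bool" where
  "continuous_functional B nrm \<phi> \<longleftrightarrow>
     (\<forall>x\<in>B. \<forall>e>0. \<exists>d>0. \<forall>y\<in>B. nrm (y - x) < d \<longrightarrow> \<bar>\<phi> y - \<phi> x\<bar> < e)"

text \<open>The operator norm is extended-real-valued, so it is \<open>\<infinity>\<close> for unbounded operators.\<close>

definition op_norm ::
    "'v set \<Rightarrow> ('v \<Rightarrow> real) \<Rightarrow> ('w \<Rightarrow> real) \<Rightarrow> ('v \<Rightarrow> 'w) \<Rightarrow> ereal" where
  "op_norm A nA nB T = (SUP f\<in>{f \<in> A. nA f \<le> 1}. ereal (nB (T f)))"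

definition bounded_operator ::
    "'v::real_vector set \<Rightarrow> ('v \<Rightarrow> real) \<Rightarrow> 'w::real_vector set \<Rightarrow> ('w \<Rightarrow> real) \<Rightarrow> ('v \<Rightarrow> 'w) \<Rightarrow> bool"
  where
  "bounded_operator A nA B nB T \<longleftrightarrow>
     (\<forall>x\<in>A. T x \<in> B) \<and>
     (\<forall>x\<in>A. \<forall>y\<in>A. T (x + y) = T x + T y) \<and>
     (\<forall>c. \<forall>x\<in>A. T (c *\<^sub>R x) = c *\<^sub>R T x) \<and>
     op_norm A nA nB T < \<infinity>"

definition bounded_markov_operator ::
    "'a::topological_space signed_measure set \<Rightarrow> ('a signed_measure \<Rightarrow> real) \<Rightarrow>
     ('a signed_measure \<Rightarrow> 'a signed_measure) \<Rightarrow> bool" where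
  "bounded_markov_operator B nrm T \<longleftrightarrow>
     bounded_operator B nrm B nrm T \<and>
     (\<forall>\<mu>\<in>B. positive_measure \<mu> \<longrightarrow>
        positive_measure (T \<mu>) \<and> total_mass (T \<mu>) = total_mass \<mu>)"

definition neumann_sums ::
    "('v::real_vector \<Rightarrow> real) \<Rightarrow> ('v \<Rightarrow> 'v) \<Rightarrow> 'v \<Rightarrow> 'v \<Rightarrow> bool" where
  "neumann_sums nrm T g r \<longleftrightarrow> (\<lambda>n. nrm ((\<Sum>i<n. (T ^^ i) g) - r)) \<longlonglongrightarrow> 0"

text \<open>
  The operator \<open>\<Sum>i. T ^^ i\<close>, written $(Id - T)^{-1}$, with the series converging pointwise in the
  normed space \<open>(B, nrm)\<close>. The value is meaningful at those \<open>g\<close> where the series converges in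
  \<open>B\<close>; the limit is then unique because \<open>nrm\<close> is a norm on \<open>B\<close>.
\<close>

definition neumann_inverse ::
    "'v::real_vector set \<Rightarrow> ('v \<Rightarrow> real) \<Rightarrow> ('v \<Rightarrow> 'v) \<Rightarrow> 'v \<Rightarrow> 'v" where
  "neumann_inverse B nrm T g = (THE r. r \<in> B \<and> neumann_sums nrm T g r)"

end

theory Submission
  imports Defs
begin

text \<open>
  Since \<open>L \<delta>\<close> fixes \<open>h \<delta>\<close> and \<open>L 0\<close> fixes \<open>h 0\<close>,
  \[ (Id - L_0)(h_\delta - h_0) = (L_\delta - L_0) h_\delta . \]
  As \<open>h \<delta> - h 0\<close> is a zero-average element of the smallest space, the powers of \<open>L 0\<close> send it to zero,
  so the Neumann series of the left-hand side
  telescopes to \<open>h \<delta> - h 0\<close> (lemma \<open>neumann_inverse_resolvent\<close>).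
  Dividing by \<open>\<delta>\<close> and splitting \<open>h \<delta>\<close> into \<open>h 0\<close> and \<open>h \<delta> - h 0\<close> gives
  \[ \frac{h_\delta - h_0}{\delta} - (Id - L_0)^{-1} \dot L h_0 =
     (Id - L_0)^{-1} \left[ \left( \frac{L_\delta - L_0}{\delta} h_0 - \dot L h_0 \right)
       + \frac{L_\delta - L_0}{\delta} (h_\delta - h_0) \right] . \]
  The resolvent is bounded on zero-average measures in the weak norm. The first summand tends to 0
  by the definition of the derivative operator, and the second has weak norm at most \<open>K\<close> times the
  strong norm of \<open>h \<delta> - h 0\<close>.

  It remains to see that \<open>h \<delta>\<close> tends to \<open>h 0\<close> in the strong norm (statistical stability). A vector
  that is almost fixed by a bounded operator is almost fixed by each given power of it; here
  \<open>h \<delta> - h 0\<close> is almost fixed by \<open>L 0\<close>, up to \<open>K \<delta> M\<close>, while a high power of \<open>L 0\<close> makes it small,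
  uniformly in \<open>\<delta>\<close>, because it stays bounded in the strongest norm. This is lemma
  \<open>almost_fixed_tendsto_zero\<close>.
\<close>

section \<open>Norms on subspaces\<close>

lemma normed_subspaceD:
  assumes "normed_subspace B nrm"
  shows "subspace B"
    and "x \<in> B \<Longrightarrow> 0 \<le> nrm x"
    and "x \<in> B \<Longrightarrow> nrm x = 0 \<longleftrightarrow> x = 0"
    and "x \<in> B \<Longrightarrow> nrm (c *\<^sub>R x) = \<bar>c\<bar> * nrm x"
    and "x \<in> B \<Longrightarrow> y \<in> B \<Longrightarrow> nrm (x + y) \<le> nrm x + nrm y"
  using assms unfolding normed_subspace_def by blast+

lemma normed_subspace_zero:
  assumes "normed_subspace B nrm"
  shows "nrm 0 = 0"
  using normed_subspaceD(1,3)[OF assms] subspace_0 by blast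

lemma normed_subspace_minus_commute:
  assumes "normed_subspace B nrm" "x \<in> B" "y \<in> B"
  shows "nrm (x - y) = nrm (y - x)"
  using normed_subspaceD(4)[OF assms(1) subspace_diff[OF normed_subspaceD(1)[OF assms(1)]
      assms(2,3)], of "-1"]
  by simp

lemma normed_subspace_triangle_minus:
  assumes "normed_subspace B nrm" "x \<in> B" "y \<in> B"
  shows "nrm (x - y) \<le> nrm x + nrm y"
  using normed_subspaceD(4)[OF assms(1,3), of "-1"]
    normed_subspaceD(5)[OF assms(1,2) subspace_neg[OF normed_subspaceD(1)[OF assms(1)] assms(3)]]
  by simp

lemma normed_subspace_sum_le:
  assumes "normed_subspace B nrm" "\<And>i. i \<in> I \<Longrightarrow> f i \<in> B"
  shows "nrm (sum f I) \<le> (\<Sum>i\<in>I. nrm (f i))"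
  using assms(2)
proof (induction I rule: infinite_finite_induct)
  case (insert i I)
  have "sum f I \<in> B"
    using insert.prems by (intro subspace_sum normed_subspaceD(1)[OF assms(1)]) auto
  then have "nrm (f i + sum f I) \<le> nrm (f i) + nrm (sum f I)"
    using insert.prems by (intro normed_subspaceD(5)[OF assms(1)]) auto
  then show ?case
    using insert by force
qed (simp_all add: normed_subspace_zero[OF assms(1)])

lemma normed_subspace_subset:
  assumes "normed_subspace B nrm" "subspace V" "V \<subseteq> B"
  shows "normed_subspace V nrm"
  using assms unfolding normed_subspace_def by (metis subsetD)

section \<open>Bounded operators\<close>

lemma op_norm_bound:
  assumes A: "normed_subspace A nA" and B: "normed_subspace B nB"
    and mem: "\<And>x. x \<in> A \<Longrightarrow> T x \<in> B"
    and scale: "\<And>c x. x \<in> A \<Longrightarrow> T (c *\<^sub>R x) = c *\<^sub>R T x"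
    and le: "op_norm A nA nB T \<le> ereal C" and x: "x \<in> A"
  shows "nB (T x) \<le> C * nA x"
proof (cases "x = 0")
  case True
  have "T 0 = 0"
    using scale[OF x, of 0] by simp
  with True show ?thesis
    by (simp add: normed_subspace_zero[OF A] normed_subspace_zero[OF B])
next
  case False
  then have pos: "nA x > 0"
    using normed_subspaceD(2,3)[OF A x] by simp
  define u where "u = (1 / nA x) *\<^sub>R x"
  have "u \<in> A" "nA u \<le> 1"
    using pos normed_subspaceD(4)[OF A x] subspace_scale[OF normed_subspaceD(1)[OF A] x]
    by (simp_all add: u_def)
  then have "ereal (nB (T u)) \<le> op_norm A nA nB T"
    unfolding op_norm_def by (intro SUP_upper) simp
  with le have "nB (T u) \<le> C"
    using order_trans ereal_less_eq(3) by blast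
  moreover have "nB (T u) = nB (T x) / nA x"
    using pos by (simp add: u_def scale[OF x] normed_subspaceD(4)[OF B mem[OF x]])
  ultimately show ?thesis
    using pos by (simp add: field_simps)
qed

lemma bounded_operatorD:
  assumes "bounded_operator A nA B nB T"
  shows "x \<in> A \<Longrightarrow> T x \<in> B"
    and "x \<in> A \<Longrightarrow> y \<in> A \<Longrightarrow> T (x + y) = T x + T y"
    and "x \<in> A \<Longrightarrow> T (c *\<^sub>R x) = c *\<^sub>R T x"
    and "op_norm A nA nB T < \<infinity>"
  using assms unfolding bounded_operator_def by blast+

lemma bounded_operator_bound:
  assumes A: "normed_subspace A nA" and B: "normed_subspace B nB"
    and T: "bounded_operator A nA B nB T"
  obtains C where "C \<ge> 0" "\<And>x. x \<in> A \<Longrightarrow> nB (T x) \<le> C * nA x"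
proof -
  obtain C where C: "op_norm A nA nB T \<le> ereal C"
    using bounded_operatorD(4)[OF T] by (cases "op_norm A nA nB T") auto
  have "nB (T x) \<le> max C 0 * nA x" if x: "x \<in> A" for x
  proof -
    have "nB (T x) \<le> C * nA x"
      by (rule op_norm_bound[OF A B bounded_operatorD(1,3)[OF T] C x])
    also have "\<dots> \<le> max C 0 * nA x"
      by (intro mult_right_mono normed_subspaceD(2)[OF A x]) simp
    finally show ?thesis .
  qed
  then show thesis
    using that[of "max C 0"] by simp
qed

lemma bounded_operator_diff:
  assumes "normed_subspace A nA" "bounded_operator A nA B nB T" "x \<in> A" "y \<in> A"
  shows "T (x - y) = T x - T y"
  using bounded_operatorD(2)[OF assms(2,3) subspace_neg[OF normed_subspaceD(1)[OF assms(1)] assms(4)]]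
    bounded_operatorD(3)[OF assms(2,4), of "-1"]
  by simp

lemma funpow_mem:
  assumes "\<And>x. x \<in> A \<Longrightarrow> T x \<in> A" "x \<in> A"
  shows "(T ^^ n) x \<in> A"
  using assms by (induction n) auto

lemma bounded_operator_funpow_diff:
  assumes A: "normed_subspace A nA" and T: "bounded_operator A nA A nA T"
    and "x \<in> A" "y \<in> A"
  shows "(T ^^ n) (x - y) = (T ^^ n) x - (T ^^ n) y"
proof (induction n)
  case (Suc n)
  have "(T ^^ n) x \<in> A" "(T ^^ n) y \<in> A"
    by (intro funpow_mem bounded_operatorD(1)[OF T] assms; assumption)+
  then show ?case
    by (simp add: Suc bounded_operator_diff[OF A T])
qed simp

lemma funpow_norm_bound:
  fixes nA :: "'v \<Rightarrow> real"
  assumes "\<And>x. x \<in> A \<Longrightarrow> T x \<in> A" "\<And>x. x \<in> A \<Longrightarrow> nA (T x) \<le> C * nA x" "C \<ge> 0" "x \<in> A"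
  shows "nA ((T ^^ n) x) \<le> C ^ n * nA x"
proof (induction n)
  case (Suc n)
  have "nA ((T ^^ Suc n) x) \<le> C * nA ((T ^^ n) x)"
    using assms(2)[OF funpow_mem[of A T x n]] assms(1,4) by simp
  also have "\<dots> \<le> C * (C ^ n * nA x)"
    by (intro mult_left_mono Suc assms(3))
  finally show ?case
    by simp
qed simp

section \<open>Neumann series\<close>

lemma neumann_partial_sum_telescopes:
  assumes A: "normed_subspace A nA" and T: "bounded_operator A nA A nA T" and x: "x \<in> A"
  shows "(\<Sum>i<n. (T ^^ i) (x - T x)) = x - (T ^^ n) x"
proof -
  have "(\<Sum>i<n. (T ^^ i) (x - T x)) = (\<Sum>i<n. (T ^^ i) x - (T ^^ Suc i) x)"
    using bounded_operator_funpow_diff[OF A T x bounded_operatorD(1)[OF T x]]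
    by (simp add: funpow_swap1)
  also have "\<dots> = x - (T ^^ n) x"
    by (subst sum_lessThan_telescope') simp
  finally show ?thesis .
qed

lemma neumann_inverse_eq:
  assumes B: "normed_subspace B nrm" and T: "\<And>x. x \<in> B \<Longrightarrow> T x \<in> B" and g: "g \<in> B"
    and r: "r \<in> B" "neumann_sums nrm T g r"
  shows "neumann_inverse B nrm T g = r"
  unfolding neumann_inverse_def
proof (rule the_equality)
  fix s assume s: "s \<in> B \<and> neumann_sums nrm T g s"
  define S where "S n = (\<Sum>i<n. (T ^^ i) g)" for n
  note sub = normed_subspaceD(1)[OF B]
  have S: "S n \<in> B" for n
    unfolding S_def by (intro subspace_sum sub funpow_mem T g; assumption)
  have sr: "s - r \<in> B"
    using s r(1) sub by (simp add: subspace_diff)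
  have "nrm (s - r) \<le> nrm (S n - r) + nrm (S n - s)" for n
    using normed_subspace_triangle_minus[OF B, of "S n - r" "S n - s"] S[of n] s r(1)
    by (simp add: subspace_diff[OF sub])
  moreover have "(\<lambda>n. nrm (S n - r) + nrm (S n - s)) \<longlonglongrightarrow> 0 + 0"
    using s r(2) unfolding neumann_sums_def S_def by (intro tendsto_add) auto
  ultimately have "nrm (s - r) \<le> 0"
    by (intro LIMSEQ_le_const[of _ "0::real"]) auto
  then show "s = r"
    using normed_subspaceD(2,3)[OF B sr] by simp
qed (use r in simp)

text \<open>
  The partial sums telescope to \<open>x - (T ^^ n) x\<close>. Here \<open>x\<close> will lie in a subspace with a stronger norm,
  and a decay estimate available there controls the remainder in the weaker norm \<open>nrm\<close>.
\<close>

lemma neumann_inverse_resolvent: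
  assumes B: "normed_subspace B nrm" and T: "bounded_operator B nrm B nrm T" and x: "x \<in> B"
    and lim: "(\<lambda>n. nrm ((T ^^ n) x)) \<longlonglongrightarrow> 0"
  shows "neumann_inverse B nrm T (x - T x) = x"
proof (rule neumann_inverse_eq[OF B bounded_operatorD(1)[OF T] _ x])
  note sub = normed_subspaceD(1)[OF B]
  show "x - T x \<in> B"
    by (intro subspace_diff sub x bounded_operatorD(1)[OF T])
  have "nrm ((\<Sum>i<n. (T ^^ i) (x - T x)) - x) = nrm ((T ^^ n) x)" for n
    unfolding neumann_partial_sum_telescopes[OF B T x]
    using normed_subspaceD(4)[OF B funpow_mem[of B T x n], of "-1"] bounded_operatorD(1)[OF T] x
    by simp
  then show "neumann_sums nrm T (x - T x) x"
    using lim by (simp add: neumann_sums_def)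
qed

section \<open>Vectors that are almost fixed\<close>

lemma almost_fixed_power:
  assumes B: "normed_subspace B nrm" and T: "bounded_operator B nrm B nrm T"
    and C: "C \<ge> 0" "\<And>y. y \<in> B \<Longrightarrow> nrm (T y) \<le> C * nrm y" and x: "x \<in> B"
  shows "nrm (x - (T ^^ n) x) \<le> (\<Sum>i<n. C ^ i) * nrm (x - T x)"
proof -
  have d: "x - T x \<in> B"
    by (intro subspace_diff normed_subspaceD(1)[OF B] x bounded_operatorD(1)[OF T])
  have "nrm (x - (T ^^ n) x) = nrm (\<Sum>i<n. (T ^^ i) (x - T x))"
    by (simp add: neumann_partial_sum_telescopes[OF B T x])
  also have "\<dots> \<le> (\<Sum>i<n. nrm ((T ^^ i) (x - T x)))"
    by (intro normed_subspace_sum_le[OF B] funpow_mem bounded_operatorD(1)[OF T] d; assumption)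
  also have "\<dots> \<le> (\<Sum>i<n. C ^ i * nrm (x - T x))"
    by (intro sum_mono funpow_norm_bound[of B] bounded_operatorD(1)[OF T] C d; assumption)
  finally show ?thesis
    by (simp add: sum_distrib_right)
qed

text \<open>
  The number \<open>n\<close> of iterations is chosen first, to make \<open>b n\<close> small; only then does the parameter
  run along \<open>F\<close>, with the geometric factor of \<open>almost_fixed_power\<close> a constant. This order matters,
  because that factor may grow exponentially in \<open>n\<close>.
\<close>

lemma almost_fixed_tendsto_zero:
  assumes B: "normed_subspace B nrm" and T: "bounded_operator B nrm B nrm T"
    and x: "\<forall>\<^sub>F \<delta> in F. x \<delta> \<in> B"
    and fixed: "((\<lambda>\<delta>. nrm (x \<delta> - T (x \<delta>))) \<longlongrightarrow> 0) F"
    and power: "\<forall>\<^sub>F \<delta> in F. \<forall>n. nrm ((T ^^ n) (x \<delta>)) \<le> b n"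
    and b: "b \<longlonglongrightarrow> 0"
  shows "((\<lambda>\<delta>. nrm (x \<delta>)) \<longlongrightarrow> 0) F"
proof (rule tendstoI)
  fix e :: real assume e: "e > 0"
  obtain C where C: "C \<ge> 0" "\<And>y. y \<in> B \<Longrightarrow> nrm (T y) \<le> C * nrm y"
    using bounded_operator_bound[OF B B T] by metis
  obtain n where n: "b n < e / 2"
    using order_tendstoD(2)[OF b, of "e / 2"] e by (auto simp: eventually_sequentially)
  have "((\<lambda>\<delta>. (\<Sum>i<n. C ^ i) * nrm (x \<delta> - T (x \<delta>))) \<longlongrightarrow> (\<Sum>i<n. C ^ i) * 0) F"
    by (intro tendsto_mult_left fixed)
  then have "\<forall>\<^sub>F \<delta> in F. (\<Sum>i<n. C ^ i) * nrm (x \<delta> - T (x \<delta>)) < e / 2"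
    using e by (intro order_tendstoD(2)[where y = "(\<Sum>i<n. C ^ i) * 0"]) auto
  with x power show "\<forall>\<^sub>F \<delta> in F. dist (nrm (x \<delta>)) 0 < e"
  proof eventually_elim
    case (elim \<delta>)
    have T_mem: "(T ^^ n) (x \<delta>) \<in> B"
      by (intro funpow_mem bounded_operatorD(1)[OF T] elim; assumption)
    have "nrm (x \<delta>) \<le> nrm (x \<delta> - (T ^^ n) (x \<delta>)) + nrm ((T ^^ n) (x \<delta>))"
      using normed_subspaceD(5)[OF B subspace_diff[OF normed_subspaceD(1)[OF B] elim(1) T_mem] T_mem]
      by simp
    also have "\<dots> < e / 2 + e / 2"
      using almost_fixed_power[OF B T C elim(1), of n] elim n by (smt (verit))
    finally show ?case
      using normed_subspaceD(2)[OF B elim(1)] by simp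
  qed
qed

section \<open>Zero-average measures\<close>

lemma total_mass_linear:
  "total_mass 0 = 0"
  "total_mass (\<mu> + \<nu>) = total_mass \<mu> + total_mass \<nu>"
  "total_mass (\<mu> - \<nu>) = total_mass \<mu> - total_mass \<nu>"
  "total_mass (c *\<^sub>R \<mu>) = c * total_mass \<mu>"
  by (simp_all add: total_mass_def zero_signed_measure.rep_eq plus_signed_measure.rep_eq
      minus_signed_measure.rep_eq scaleR_signed_measure.rep_eq)

lemma subspace_zero_average:
  assumes "subspace B"
  shows "subspace (zero_average B)"
  using assms by (auto simp: subspace_def zero_average_def total_mass_linear)

lemma bounded_markov_operator_total_mass:
  assumes "bounded_markov_operator B nrm T" "\<mu> \<in> B" "probability_measure \<mu>"
  shows "total_mass (T \<mu>) = 1"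
  using assms by (simp add: bounded_markov_operator_def probability_measure_def)

section \<open>Linear response\<close>

theorem theorem1:
  fixes Bss Bs Bw :: "'a::metric_space signed_measure set"
    and nss ns nw :: "'a signed_measure \<Rightarrow> real"
    and L :: "real \<Rightarrow> 'a signed_measure \<Rightarrow> 'a signed_measure"
    and h :: "real \<Rightarrow> 'a signed_measure"
    and Ldot_h0 :: "'a signed_measure"
    and \<delta>bar M K :: real
    and a :: "nat \<Rightarrow> real"
  assumes compact_X: "compact (UNIV :: 'a set)"
    and normed_ss: "normed_subspace Bss nss"
    and normed_s: "normed_subspace Bs ns"
    and normed_w: "normed_subspace Bw nw"
    and inclusions: "Bss \<subseteq> Bs" "Bs \<subseteq> Bw"
    and norms_s_ss: "\<And>\<mu>. \<mu> \<in> Bss \<Longrightarrow> ns \<mu> \<le> nss \<mu>"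
    and norms_w_s: "\<And>\<mu>. \<mu> \<in> Bs \<Longrightarrow> nw \<mu> \<le> ns \<mu>"
    and mass_ss: "continuous_functional Bss nss total_mass"
    and mass_s: "continuous_functional Bs ns total_mass"
    and mass_w: "continuous_functional Bw nw total_mass"
    and \<delta>bar_pos: "\<delta>bar > 0"
    and markov_ss: "\<And>\<delta>. \<delta> \<in> {0..<\<delta>bar} \<Longrightarrow> bounded_markov_operator Bss nss (L \<delta>)"
    and markov_s: "\<And>\<delta>. \<delta> \<in> {0..<\<delta>bar} \<Longrightarrow> bounded_markov_operator Bs ns (L \<delta>)"
    and markov_w: "\<And>\<delta>. \<delta> \<in> {0..<\<delta>bar} \<Longrightarrow> bounded_markov_operator Bw nw (L \<delta>)"
    and LR1: "\<And>\<delta>. \<delta> \<in> {0..<\<delta>bar} \<Longrightarrow>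
                h \<delta> \<in> Bss \<and> probability_measure (h \<delta>) \<and> L \<delta> (h \<delta>) = h \<delta>"
    and LR1_bound: "M \<ge> 0" "\<And>\<delta>. \<delta> \<in> {0..<\<delta>bar} \<Longrightarrow> nss (h \<delta>) \<le> M"
    and LR2: "a \<longlonglongrightarrow> 0"
             "\<And>g n. g \<in> zero_average Bss \<Longrightarrow> ns ((L 0 ^^ n) g) \<le> a n * nss g"
    and LR3_convergent: "\<And>g. g \<in> zero_average Bw \<Longrightarrow> \<exists>r\<in>Bw. neumann_sums nw (L 0) g r"
    and LR3_bounded: "bounded_operator (zero_average Bw) nw (zero_average Bw) nw
                        (neumann_inverse Bw nw (L 0))"
    and LR4_K: "K \<ge> 0"
    and LR4_s_w: "\<And>\<delta>. \<delta> \<in> {0..<\<delta>bar} \<Longrightarrow>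
                    op_norm Bs ns nw (\<lambda>f. L 0 f - L \<delta> f) \<le> ereal (K * \<delta>)"
    and LR4_ss_s: "\<And>\<delta>. \<delta> \<in> {0..<\<delta>bar} \<Longrightarrow>
                     op_norm Bss nss ns (\<lambda>f. L 0 f - L \<delta> f) \<le> ereal (K * \<delta>)"
    and LR4_deriv_mem: "Ldot_h0 \<in> zero_average Bw"
    and LR4_deriv:
      "((\<lambda>\<delta>. nw ((L \<delta> (h 0) - L 0 (h 0)) /\<^sub>R \<delta> - Ldot_h0)) \<longlongrightarrow> 0) (at 0 within {0..<\<delta>bar})"
  shows "((\<lambda>\<delta>. nw ((h \<delta> - h 0) /\<^sub>R \<delta> - neumann_inverse Bw nw (L 0) Ldot_h0)) \<longlongrightarrow> 0)
           (at 0 within {0..<\<delta>bar})"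
proof -
  let ?F = "at (0::real) within {0..<\<delta>bar}"
  let ?N = "neumann_inverse Bw nw (L 0)" and ?Vw = "zero_average Bw"
  note sub_ss = normed_subspaceD(1)[OF normed_ss]
  note sub_w = normed_subspaceD(1)[OF normed_w]
  note sub_s = normed_subspaceD(1)[OF normed_s]
  have zero: "0 \<in> {0..<\<delta>bar}"
    using \<delta>bar_pos by simp
  have h_ss: "h \<delta> \<in> Bss" and h_prob: "probability_measure (h \<delta>)" and h_fix: "L \<delta> (h \<delta>) = h \<delta>"
    if "\<delta> \<in> {0..<\<delta>bar}" for \<delta>
    using LR1[OF that] by auto
  have bop_ss: "bounded_operator Bss nss Bss nss (L \<delta>)"
    and bop_s: "bounded_operator Bs ns Bs ns (L \<delta>)"
    and bop_w: "bounded_operator Bw nw Bw nw (L \<delta>)" if "\<delta> \<in> {0..<\<delta>bar}" for \<delta>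
    using markov_ss[OF that] markov_s[OF that] markov_w[OF that]
    by (simp_all add: bounded_markov_operator_def)
  have range: "\<forall>\<^sub>F \<delta> in ?F. \<delta> \<in> {0..<\<delta>bar} \<and> \<delta> > 0"
    by (auto simp: eventually_at_filter)

  have close_ss_s: "ns (L 0 f - L \<delta> f) \<le> K * \<delta> * nss f"
    if \<delta>: "\<delta> \<in> {0..<\<delta>bar}" and f: "f \<in> Bss" for \<delta> f
  proof (rule op_norm_bound[OF normed_ss normed_s _ _ LR4_ss_s[OF \<delta>] f])
    show "L 0 g - L \<delta> g \<in> Bs" if "g \<in> Bss" for g
      using bounded_operatorD(1)[OF bop_ss[OF zero] that] bounded_operatorD(1)[OF bop_ss[OF \<delta>] that]
        inclusions(1) by (intro subspace_diff sub_s) auto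
    show "L 0 (c *\<^sub>R g) - L \<delta> (c *\<^sub>R g) = c *\<^sub>R (L 0 g - L \<delta> g)" if "g \<in> Bss" for c g
      using bounded_operatorD(3)[OF bop_ss[OF zero] that] bounded_operatorD(3)[OF bop_ss[OF \<delta>] that]
      by (simp add: scaleR_diff_right)
  qed
  have close_s_w: "nw (L 0 f - L \<delta> f) \<le> K * \<delta> * ns f"
    if \<delta>: "\<delta> \<in> {0..<\<delta>bar}" and f: "f \<in> Bs" for \<delta> f
  proof (rule op_norm_bound[OF normed_s normed_w _ _ LR4_s_w[OF \<delta>] f])
    show "L 0 g - L \<delta> g \<in> Bw" if "g \<in> Bs" for g
      using bounded_operatorD(1)[OF bop_s[OF zero] that] bounded_operatorD(1)[OF bop_s[OF \<delta>] that]
        inclusions(2) by (intro subspace_diff sub_w) auto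
    show "L 0 (c *\<^sub>R g) - L \<delta> (c *\<^sub>R g) = c *\<^sub>R (L 0 g - L \<delta> g)" if "g \<in> Bs" for c g
      using bounded_operatorD(3)[OF bop_s[OF zero] that] bounded_operatorD(3)[OF bop_s[OF \<delta>] that]
      by (simp add: scaleR_diff_right)
  qed

  define x where "x \<delta> = h \<delta> - h 0" for \<delta>
  have x_V: "x \<delta> \<in> zero_average Bss" if "\<delta> \<in> {0..<\<delta>bar}" for \<delta>
    using h_ss[OF that] h_ss[OF zero] h_prob[OF that] h_prob[OF zero] subspace_diff[OF sub_ss]
    by (simp add: x_def zero_average_def total_mass_linear probability_measure_def)
  then have x_ss: "x \<delta> \<in> Bss" and x_s: "x \<delta> \<in> Bs" and x_w: "x \<delta> \<in> Bw"
    if "\<delta> \<in> {0..<\<delta>bar}" for \<delta>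
    using inclusions that by (auto simp: zero_average_def)
  have x_bound: "nss (x \<delta>) \<le> 2 * M" if "\<delta> \<in> {0..<\<delta>bar}" for \<delta>
    using normed_subspace_triangle_minus[OF normed_ss h_ss[OF that] h_ss[OF zero]]
      LR1_bound(2)[OF that] LR1_bound(2)[OF zero] by (simp add: x_def)
  have x_resolvent: "x \<delta> - L 0 (x \<delta>) = L \<delta> (h \<delta>) - L 0 (h \<delta>)" if "\<delta> \<in> {0..<\<delta>bar}" for \<delta>
    using bounded_operator_diff[OF normed_ss bop_ss[OF zero] h_ss[OF that] h_ss[OF zero]]
    by (simp add: x_def h_fix[OF that] h_fix[OF zero])

  have stability: "((\<lambda>\<delta>. ns (x \<delta>)) \<longlongrightarrow> 0) ?F"
  proof (rule almost_fixed_tendsto_zero[OF normed_s bop_s[OF zero]])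
    show "\<forall>\<^sub>F \<delta> in ?F. x \<delta> \<in> Bs"
      using range by eventually_elim (use x_s in blast)
    have bound: "\<forall>\<^sub>F \<delta> in ?F. ns (x \<delta> - L 0 (x \<delta>)) \<le> K * \<delta> * M"
      using range
    proof eventually_elim
      case (elim \<delta>)
      then have \<delta>: "\<delta> \<in> {0..<\<delta>bar}"
        by simp
      note mem = h_ss[OF \<delta>] bounded_operatorD(1)[OF bop_ss[OF \<delta>] h_ss[OF \<delta>]]
        bounded_operatorD(1)[OF bop_ss[OF zero] h_ss[OF \<delta>]]
      have "ns (x \<delta> - L 0 (x \<delta>)) = ns (L 0 (h \<delta>) - L \<delta> (h \<delta>))"
        unfolding x_resolvent[OF \<delta>]
        using mem inclusions(1) by (intro normed_subspace_minus_commute[OF normed_s]) auto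
      also have "\<dots> \<le> K * \<delta> * nss (h \<delta>)"
        by (rule close_ss_s[OF \<delta> mem(1)])
      also have "\<dots> \<le> K * \<delta> * M"
        using LR1_bound(2)[OF \<delta>] LR4_K elim by (intro mult_left_mono) auto
      finally show ?case .
    qed
    have "((\<lambda>\<delta>. K * \<delta> * M) \<longlongrightarrow> K * 0 * M) ?F"
      by (intro tendsto_intros)
    then have upper: "((\<lambda>\<delta>. K * \<delta> * M) \<longlongrightarrow> 0) ?F"
      by simp
    have lower: "\<forall>\<^sub>F \<delta> in ?F. 0 \<le> ns (x \<delta> - L 0 (x \<delta>))"
      using range
      by eventually_elim (intro normed_subspaceD(2)[OF normed_s] subspace_diff sub_s
          bounded_operatorD(1)[OF bop_s[OF zero]] x_s; blast)
    show "((\<lambda>\<delta>. ns (x \<delta> - L 0 (x \<delta>))) \<longlongrightarrow> 0) ?F"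
      by (rule tendsto_sandwich[OF lower bound tendsto_const upper])
    \<comment> \<open>The absolute value covers negative \<open>a n\<close>, possible when the zero-average space is trivial.\<close>
    show "\<forall>\<^sub>F \<delta> in ?F. \<forall>n. ns ((L 0 ^^ n) (x \<delta>)) \<le> \<bar>a n\<bar> * (2 * M)"
      using range
    proof (eventually_elim, intro allI)
      fix \<delta> n assume "\<delta> \<in> {0..<\<delta>bar} \<and> \<delta> > 0"
      then have \<delta>: "\<delta> \<in> {0..<\<delta>bar}"
        by simp
      have "ns ((L 0 ^^ n) (x \<delta>)) \<le> a n * nss (x \<delta>)"
        by (rule LR2(2)[OF x_V[OF \<delta>]])
      also have "\<dots> \<le> \<bar>a n\<bar> * (2 * M)"
        using x_bound[OF \<delta>] normed_subspaceD(2)[OF normed_ss x_ss[OF \<delta>]]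
        by (intro mult_mono) auto
      finally show "ns ((L 0 ^^ n) (x \<delta>)) \<le> \<bar>a n\<bar> * (2 * M)" .
    qed
    show "(\<lambda>n. \<bar>a n\<bar> * (2 * M)) \<longlonglongrightarrow> 0"
      using tendsto_mult_right[OF tendsto_rabs_zero[OF LR2(1)], of "2 * M"] by simp
  qed

  have x_inverse: "?N (L \<delta> (h \<delta>) - L 0 (h \<delta>)) = x \<delta>" if \<delta>: "\<delta> \<in> {0..<\<delta>bar}" for \<delta>
  proof -
    have orbit: "(L 0 ^^ n) (x \<delta>) \<in> Bs" for n
      by (intro funpow_mem bounded_operatorD(1)[OF bop_s[OF zero]] x_s \<delta>; assumption)
    have "(\<lambda>n. a n * nss (x \<delta>)) \<longlonglongrightarrow> 0"
      using tendsto_mult_right[OF LR2(1)] by simp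
    then have "(\<lambda>n. nw ((L 0 ^^ n) (x \<delta>))) \<longlonglongrightarrow> 0"
    proof (rule tendsto_sandwich[OF _ _ tendsto_const, rotated 2])
      show "\<forall>\<^sub>F n in sequentially. 0 \<le> nw ((L 0 ^^ n) (x \<delta>))"
        using orbit inclusions(2) normed_subspaceD(2)[OF normed_w] by (intro always_eventually) auto
      show "\<forall>\<^sub>F n in sequentially. nw ((L 0 ^^ n) (x \<delta>)) \<le> a n * nss (x \<delta>)"
        using order_trans[OF norms_w_s[OF orbit] LR2(2)[OF x_V[OF \<delta>]]]
        by (intro always_eventually) auto
    qed
    from neumann_inverse_resolvent[OF normed_w bop_w[OF zero] x_w[OF \<delta>] this]
    show ?thesis
      by (simp add: x_resolvent[OF \<delta>])
  qed

  have normed_V: "normed_subspace ?Vw nw"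
    using subspace_zero_average[OF sub_w]
    by (rule normed_subspace_subset[OF normed_w]) (auto simp: zero_average_def)
  note sub_V = normed_subspaceD(1)[OF normed_V]
  obtain C where C: "C \<ge> 0" "\<And>g. g \<in> ?Vw \<Longrightarrow> nw (?N g) \<le> C * nw g"
    using bounded_operator_bound[OF normed_V normed_V LR3_bounded] by metis
  \<comment> \<open>Mass preservation is available for positive measures only, so differences of operators are
    seen to be zero-average on the probability measures \<open>h \<delta>\<close> and \<open>h 0\<close> separately.\<close>
  have diff_V: "L \<delta> (h \<epsilon>) - L 0 (h \<epsilon>) \<in> ?Vw" if "\<delta> \<in> {0..<\<delta>bar}" "\<epsilon> \<in> {0..<\<delta>bar}" for \<delta> \<epsilon>
  proof -
    have "h \<epsilon> \<in> Bw"
      using h_ss[OF that(2)] inclusions by auto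
    then show ?thesis
      using bounded_operatorD(1)[OF bop_w[OF that(1)]] bounded_operatorD(1)[OF bop_w[OF zero]]
        bounded_markov_operator_total_mass[OF markov_w[OF that(1)] _ h_prob[OF that(2)]]
        bounded_markov_operator_total_mass[OF markov_w[OF zero] _ h_prob[OF that(2)]]
      by (simp add: zero_average_def total_mass_linear subspace_diff[OF sub_w])
  qed

  let ?u = "\<lambda>\<delta>. (L \<delta> (h 0) - L 0 (h 0)) /\<^sub>R \<delta> - Ldot_h0"
  let ?err = "\<lambda>\<delta>. (h \<delta> - h 0) /\<^sub>R \<delta> - ?N Ldot_h0"
  have err: "?err \<delta> \<in> Bw \<and> nw (?err \<delta>) \<le> C * (nw (?u \<delta>) + K * ns (x \<delta>))"
    if \<delta>: "\<delta> \<in> {0..<\<delta>bar}" and pos: "\<delta> > 0" for \<delta>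
  proof -
    define g where "g = L \<delta> (h \<delta>) - L 0 (h \<delta>)"
    define v where "v = (L \<delta> (x \<delta>) - L 0 (x \<delta>)) /\<^sub>R \<delta>"
    have x_diff: "L \<delta> (x \<delta>) - L 0 (x \<delta>) = g - (L \<delta> (h 0) - L 0 (h 0))"
      using bounded_operator_diff[OF normed_ss bop_ss[OF \<delta>] h_ss[OF \<delta>] h_ss[OF zero]]
        bounded_operator_diff[OF normed_ss bop_ss[OF zero] h_ss[OF \<delta>] h_ss[OF zero]]
      by (simp add: x_def g_def)
    have g: "g \<in> ?Vw" and g_scaled: "g /\<^sub>R \<delta> \<in> ?Vw" and u: "?u \<delta> \<in> ?Vw" and v: "v \<in> ?Vw"
      using diff_V[OF \<delta> \<delta>] diff_V[OF \<delta> zero] LR4_deriv_mem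
      by (simp_all add: g_def v_def x_diff[unfolded g_def] subspace_diff[OF sub_V]
          subspace_scale[OF sub_V])
    have "?err \<delta> = ?N (g /\<^sub>R \<delta>) - ?N Ldot_h0"
      using x_inverse[OF \<delta>] bounded_operatorD(3)[OF LR3_bounded g] by (simp add: g_def x_def)
    also have "\<dots> = ?N (g /\<^sub>R \<delta> - Ldot_h0)"
      by (rule bounded_operator_diff[OF normed_V LR3_bounded g_scaled LR4_deriv_mem, symmetric])
    also have "g /\<^sub>R \<delta> - Ldot_h0 = ?u \<delta> + v"
      by (simp add: v_def x_diff scaleR_diff_right)
    finally have eq: "?err \<delta> = ?N (?u \<delta> + v)" .
    have uv: "?u \<delta> + v \<in> ?Vw"
      by (rule subspace_add[OF sub_V u v])
    have "nw v = nw (L 0 (x \<delta>) - L \<delta> (x \<delta>)) / \<delta>"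
    proof -
      have mem: "L \<delta> (x \<delta>) \<in> Bw" "L 0 (x \<delta>) \<in> Bw"
        using bounded_operatorD(1)[OF bop_w[OF \<delta>] x_w[OF \<delta>]]
          bounded_operatorD(1)[OF bop_w[OF zero] x_w[OF \<delta>]] by auto
      show ?thesis
        using pos normed_subspaceD(4)[OF normed_w subspace_diff[OF sub_w mem], of "inverse \<delta>"]
          normed_subspace_minus_commute[OF normed_w mem]
        by (simp add: v_def divide_inverse mult.commute)
    qed
    also have "\<dots> \<le> K * ns (x \<delta>)"
      using close_s_w[OF \<delta> x_s[OF \<delta>]] pos by (simp add: field_simps)
    finally have "nw v \<le> K * ns (x \<delta>)" .
    then have "nw (?u \<delta> + v) \<le> nw (?u \<delta>) + K * ns (x \<delta>)"
      using normed_subspaceD(5)[OF normed_V u v] by simp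
    then have "nw (?N (?u \<delta> + v)) \<le> C * (nw (?u \<delta>) + K * ns (x \<delta>))"
      by (intro order_trans[OF C(2)[OF uv]] mult_left_mono C(1))
    moreover have "?N (?u \<delta> + v) \<in> Bw"
      using bounded_operatorD(1)[OF LR3_bounded uv] by (simp add: zero_average_def)
    ultimately show ?thesis
      by (simp only: eq simp_thms)
  qed
  have "((\<lambda>\<delta>. C * (nw (?u \<delta>) + K * ns (x \<delta>))) \<longlongrightarrow> C * (0 + K * 0)) ?F"
    by (intro tendsto_mult_left tendsto_add LR4_deriv stability)
  then have upper: "((\<lambda>\<delta>. C * (nw (?u \<delta>) + K * ns (x \<delta>))) \<longlongrightarrow> 0) ?F"
    by simp
  show ?thesis
  proof (rule tendsto_sandwich[OF _ _ tendsto_const upper])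
    show "\<forall>\<^sub>F \<delta> in ?F. 0 \<le> nw (?err \<delta>)"
      using range by eventually_elim (use err normed_subspaceD(2)[OF normed_w] in blast)
    show "\<forall>\<^sub>F \<delta> in ?F. nw (?err \<delta>) \<le> C * (nw (?u \<delta>) + K * ns (x \<delta>))"
      using range by eventually_elim (use err in blast)
  qed
qed

end
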